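(* The functor $(\ )^{\mathsf{IS}}:\mathsf{Hil}\to\mathsf{IS}$, given by $H\mapsto H^{\mathsf{IS}}$ and $f\mapsto f^{\mathsf{IS}}$, is left adjoint to the forgetful functor $\mathrm{U}:\mathsf{IS}\to\mathsf{Hil}$.
   Context: A Hilbert algebra is an algebra $(H,\to,1)$ of type $(2,0)$ such that for all $a,b,c\in H$: $a\to(b\to a)=1$; $(a\to(b\to c))\to((a\to b)\to(a\to c))=1$; and $a\to b=b\to a=1$ implies $a=b$. It is ordered by $a\le b$ iff $a\to b=1$. $\mathsf{Hil}$ is the category of Hilbert algebras and homomorphisms. An implicative semilattice is an algebra $(H,\wedge,\to)$ such that $(H,\wedge)$ is a meet semilattice and, for all $a,b,c$, $a\wedge b\le c$ iff $a\le b\to c$; it has a greatest element $1$, which is included in the language. $\mathsf{IS}$ is the category of implicative semilattices and homomorphisms (maps preserving $\wedge,\to,1$). The forgetful functor $\mathrm{U}:\mathsf{IS}\to\mathsf{Hil}$ sends $(H,\wedge,\to,1)$ to $(H,\to,1)$ and is the identity on underlying maps. An implicative filter of a Hilbert algebra $H$ is a subset $F\subseteq H$ with $1\in F$ and such that $a\in F$, $a\to b\in F$ imply $b\in F$. It is irreducible if it is proper ($F\ne H$) and, for all implicative filters $F_1,F_2$, $F=F_1\cap F_2$ implies $F=F_1$ or $F=F_2$. $X(H)$ is the set of irreducible implicative filters of $H$, ordered by inclusion. For $a\in H$, $\varphi(a)=\{P\in X(H):a\in P\}$. $X(H)^+$ is the set of upsets of $(X(H),\subseteq)$; it is a complete Heyting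 algebra under $\cap,\cup$ and $U\Rightarrow V=(U\cap V^c]^c$, where $(Y]$ is the downset generated by $Y$ and $Y^c$ the complement in $X(H)$. The map $\varphi:H\to X(H)^+$ is an injective homomorphism of Hilbert algebras. $H^{\mathsf{IS}}$ is the implicative subsemilattice (closed under $\cap$, $\Rightarrow$, top $X(H)$) of $X(H)^+$ generated by $\varphi[H]$. For a homomorphism $f:H\to G$ of Hilbert algebras, $R_f\subseteq X(G)\times X(H)$ is defined by $(P,Q)\in R_f$ iff $f^{-1}(P)\subseteq Q$, and $R_f(P)=\{Q\in X(H):(P,Q)\in R_f\}$. The map $f^{\mathsf{IS}}:H^{\mathsf{IS}}\to G^{\mathsf{IS}}$ is $f^{\mathsf{IS}}(U)=\{P\in X(G):R_f(P)\subseteq U\}$. These assignments define a functor $(\ )^{\mathsf{IS}}:\mathsf{Hil}\to\mathsf{IS}$. *)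

theory Defs
  imports "HOL-Algebra.Congruence" "HOL-Library.FuncSet" HOL.Hull
begin

record 'a hil = "'a partial_object" +
  imp :: "'a \<Rightarrow> 'a \<Rightarrow> 'a" (infixr \<open>\<leadsto>\<index>\<close> 60)
  unit :: "'a" (\<open>\<one>\<index>\<close>)

record 'a isl = "'a hil" +
  meet :: "'a \<Rightarrow> 'a \<Rightarrow> 'a" (infixl \<open>\<sqinter>\<index>\<close> 70)

locale hilbert_algebra =
  fixes H (structure)
  assumes imp_closed: "\<lbrakk>a \<in> carrier H; b \<in> carrier H\<rbrakk> \<Longrightarrow> a \<leadsto> b \<in> carrier H"
    and unit_closed: "\<one> \<in> carrier H"
    and imp_K: "\<lbrakk>a \<in> carrier H; b \<in> carrier H\<rbrakk> \<Longrightarrow> a \<leadsto> (b \<leadsto> a) = \<one>"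
    and imp_S: "\<lbrakk>a \<in> carrier H; b \<in> carrier H; c \<in> carrier H\<rbrakk> \<Longrightarrow>
      (a \<leadsto> (b \<leadsto> c)) \<leadsto> ((a \<leadsto> b) \<leadsto> (a \<leadsto> c)) = \<one>"
    and imp_antisym: "\<lbrakk>a \<in> carrier H; b \<in> carrier H; a \<leadsto> b = \<one>; b \<leadsto> a = \<one>\<rbrakk> \<Longrightarrow> a = b"

definition isl_le :: "('a, 'm) isl_scheme \<Rightarrow> 'a \<Rightarrow> 'a \<Rightarrow> bool"  (\<open>(_ \<sqsubseteq>\<index> _)\<close> [51, 51] 50)
  where "a \<sqsubseteq>\<^bsub>G\<^esub> b \<longleftrightarrow> a \<sqinter>\<^bsub>G\<^esub> b = a"

locale implicative_semilattice =
  fixes G (structure)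
  assumes meet_closed: "\<lbrakk>a \<in> carrier G; b \<in> carrier G\<rbrakk> \<Longrightarrow> a \<sqinter> b \<in> carrier G"
    and imp_closed: "\<lbrakk>a \<in> carrier G; b \<in> carrier G\<rbrakk> \<Longrightarrow> a \<leadsto> b \<in> carrier G"
    and unit_closed: "\<one> \<in> carrier G"
    and meet_assoc: "\<lbrakk>a \<in> carrier G; b \<in> carrier G; c \<in> carrier G\<rbrakk> \<Longrightarrow>
      (a \<sqinter> b) \<sqinter> c = a \<sqinter> (b \<sqinter> c)"
    and meet_commute: "\<lbrakk>a \<in> carrier G; b \<in> carrier G\<rbrakk> \<Longrightarrow> a \<sqinter> b = b \<sqinter> a"
    and meet_idem: "a \<in> carrier G \<Longrightarrow> a \<sqinter> a = a"
    and residuation: "\<lbrakk>a \<in> carrier G; b \<in> carrier G; c \<in> carrier G\<rbrakk> \<Longrightarrow>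
      a \<sqinter> b \<sqsubseteq> c \<longleftrightarrow> a \<sqsubseteq> b \<leadsto> c"
    and le_unit: "a \<in> carrier G \<Longrightarrow> a \<sqsubseteq> \<one>"

text \<open>Morphisms are extensional functions (\<open>undefined\<close> outside the domain carrier), so that
  equality in a hom-set is equality of maps between carriers; identities are
  \<open>\<lambda>x \<in> carrier H. x\<close> and composition is \<^const>\<open>compose\<close>.\<close>

definition hil_hom :: "('a, 'm) hil_scheme \<Rightarrow> ('b, 'n) hil_scheme \<Rightarrow> ('a \<Rightarrow> 'b) set"
  where "hil_hom H K = {f \<in> carrier H \<rightarrow>\<^sub>E carrier K.
    (\<forall>a \<in> carrier H. \<forall>b \<in> carrier H. f (a \<leadsto>\<^bsub>H\<^esub> b) = f a \<leadsto>\<^bsub>K\<^esub> f b) \<and> f \<one>\<^bsub>H\<^esub> = \<one>\<^bsub>K\<^esub>}"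

definition isl_hom :: "('a, 'm) isl_scheme \<Rightarrow> ('b, 'n) isl_scheme \<Rightarrow> ('a \<Rightarrow> 'b) set"
  where "isl_hom G K = {f \<in> carrier G \<rightarrow>\<^sub>E carrier K.
    (\<forall>a \<in> carrier G. \<forall>b \<in> carrier G. f (a \<sqinter>\<^bsub>G\<^esub> b) = f a \<sqinter>\<^bsub>K\<^esub> f b) \<and>
    (\<forall>a \<in> carrier G. \<forall>b \<in> carrier G. f (a \<leadsto>\<^bsub>G\<^esub> b) = f a \<leadsto>\<^bsub>K\<^esub> f b) \<and> f \<one>\<^bsub>G\<^esub> = \<one>\<^bsub>K\<^esub>}"

text \<open>The object part of the forgetful functor; on morphisms it is the identity.\<close>

definition forget :: "'a isl \<Rightarrow> 'a hil"
  where "forget G = \<lparr>carrier = carrier G, imp = imp G, unit = unit G\<rparr>"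

definition implicative_filter :: "('a, 'm) hil_scheme \<Rightarrow> 'a set \<Rightarrow> bool"
  where "implicative_filter H F \<longleftrightarrow> F \<subseteq> carrier H \<and> \<one>\<^bsub>H\<^esub> \<in> F \<and>
    (\<forall>a \<in> carrier H. \<forall>b \<in> carrier H. a \<in> F \<longrightarrow> a \<leadsto>\<^bsub>H\<^esub> b \<in> F \<longrightarrow> b \<in> F)"

definition irreducible_filter :: "('a, 'm) hil_scheme \<Rightarrow> 'a set \<Rightarrow> bool"
  where "irreducible_filter H F \<longleftrightarrow> implicative_filter H F \<and> F \<noteq> carrier H \<and>
    (\<forall>F1 F2. implicative_filter H F1 \<longrightarrow> implicative_filter H F2 \<longrightarrow>
      F = F1 \<inter> F2 \<longrightarrow> F = F1 \<or> F = F2)"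

definition spec :: "('a, 'm) hil_scheme \<Rightarrow> 'a set set"
  where "spec H = {P. irreducible_filter H P}"

definition phi :: "('a, 'm) hil_scheme \<Rightarrow> 'a \<Rightarrow> 'a set set"
  where "phi H a = {P \<in> spec H. a \<in> P}"

definition spec_upsets :: "('a, 'm) hil_scheme \<Rightarrow> 'a set set set"
  where "spec_upsets H = {U. U \<subseteq> spec H \<and> (\<forall>P \<in> U. \<forall>Q \<in> spec H. P \<subseteq> Q \<longrightarrow> Q \<in> U)}"

definition spec_down :: "('a, 'm) hil_scheme \<Rightarrow> 'a set set \<Rightarrow> 'a set set"
  where "spec_down H Y = {P \<in> spec H. \<exists>Q \<in> Y. P \<subseteq> Q}"

definition upset_algebra :: "('a, 'm) hil_scheme \<Rightarrow> 'a set set isl"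
  where "upset_algebra H = \<lparr>carrier = spec_upsets H,
    imp = (\<lambda>U V. spec H - spec_down H (U \<inter> (spec H - V))),
    unit = spec H,
    meet = (\<inter>)\<rparr>"

definition implicative_subsemilattice :: "('a, 'm) isl_scheme \<Rightarrow> 'a set \<Rightarrow> bool"
  where "implicative_subsemilattice G S \<longleftrightarrow> S \<subseteq> carrier G \<and> \<one>\<^bsub>G\<^esub> \<in> S \<and>
    (\<forall>a \<in> S. \<forall>b \<in> S. a \<sqinter>\<^bsub>G\<^esub> b \<in> S \<and> a \<leadsto>\<^bsub>G\<^esub> b \<in> S)"

definition IS_obj :: "('a, 'm) hil_scheme \<Rightarrow> 'a set set isl"
  where "IS_obj H = (upset_algebra H)
    \<lparr>carrier := implicative_subsemilattice (upset_algebra H) hull (phi H ` carrier H)\<rparr>"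

definition filter_rel ::
    "('a, 'm) hil_scheme \<Rightarrow> ('b, 'n) hil_scheme \<Rightarrow> ('a \<Rightarrow> 'b) \<Rightarrow> ('b set \<times> 'a set) set"
  where "filter_rel H K f =
    {(P, Q). P \<in> spec K \<and> Q \<in> spec H \<and> f -` P \<inter> carrier H \<subseteq> Q}"

definition IS_map ::
    "('a, 'm) hil_scheme \<Rightarrow> ('b, 'n) hil_scheme \<Rightarrow> ('a \<Rightarrow> 'b) \<Rightarrow> 'a set set \<Rightarrow> 'b set set"
  where "IS_map H K f =
    (\<lambda>U \<in> carrier (IS_obj H). {P \<in> spec K. filter_rel H K f `` {P} \<subseteq> U})"

text \<open>The hom-set map induced by the unit \<^const>\<open>phi\<close>, sending \<open>h\<close> to \<open>h \<circ> \<phi>\<close>.\<close>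

definition hom_transpose :: "('a, 'm) hil_scheme \<Rightarrow> ('a set set \<Rightarrow> 'b) \<Rightarrow> 'a \<Rightarrow> 'b"
  where "hom_transpose H h = compose (carrier H) h (phi H)"

end

theory Submission
  imports Defs
begin

text \<open>
  The whole adjunction rests on a description of \<open>H\<^sup>I\<^sup>S\<close> by finite sets of elements of \<open>H\<close>. For
  \<open>A \<subseteq> H\<close> let \<open>[A]\<close> be the set of irreducible filters containing \<open>A\<close>; then \<open>\<phi> a = [{a}]\<close> and
  \<open>[A] \<inter> [B] = [A \<union> B]\<close>. Because every implicative filter is the intersection of the irreducible
  filters above it (a Zorn argument, \<open>irreducible_filter_separation\<close>), an iterated implication
  \<open>x\<^sub>1 \<rightarrow> (\<dots> \<rightarrow> (x\<^sub>n \<rightarrow> y))\<close> lies in a filter \<open>F\<close> exactly if \<open>y\<close> lies in every irreducible filter above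
  \<open>F\<close> that contains all \<open>x\<^sub>i\<close> (\<open>iterated_imp_mem_iff\<close>). Read in the Heyting algebra of upsets, this
  says that \<open>[{x\<^sub>1,\<dots>,x\<^sub>n}] \<Rightarrow> [B]\<close> is \<open>[B']\<close>, where \<open>B'\<close> consists of the iterated implications
  ending in elements of \<open>B\<close>. So the sets \<open>[A]\<close> with \<open>A\<close> finite are already closed under all
  operations, and they are precisely the elements of \<open>H\<^sup>I\<^sup>S\<close>.

  For a homomorphism \<open>f\<close> the preimage of a filter is a filter, and separation gives
  \<open>f\<^sup>I\<^sup>S [A] = [f A]\<close>. As \<open>f\<close> commutes with iterated implications, \<open>f\<^sup>I\<^sup>S\<close> preserves all operations.
  The case of a singleton \<open>A\<close> is the naturality \<open>f\<^sup>I\<^sup>S \<circ> \<phi> = \<phi> \<circ> f\<close> of the unit, and functoriality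
  follows from it because homomorphisms on \<open>H\<^sup>I\<^sup>S\<close> are determined by their values on \<open>\<phi>[H]\<close>.

  For the universal property, let \<open>G\<close> be an implicative semilattice. Its implicative filters are
  upward closed and closed under meets, so \<open>\<phi> a \<inter> \<phi> b = \<phi> (a \<sqinter> b)\<close> and hence \<open>\<phi>\<close> is an isomorphism of \<open>G\<close> onto
  \<open>(U G)\<^sup>I\<^sup>S\<close>. The extension of \<open>g : H \<rightarrow> U G\<close> along \<open>\<phi>\<close> is \<open>\<phi>\<^sup>-\<^sup>1 \<circ> g\<^sup>I\<^sup>S\<close>; it is the only one since
  \<open>\<phi>[H]\<close> generates \<open>H\<^sup>I\<^sup>S\<close>.
\<close>

section \<open>Implicative filters of Hilbert algebras\<close>

context hilbert_algebra
begin

text \<open>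
  Writing \<open>t\<close> for \<open>a \<rightarrow> \<one>\<close>, an instance of \<open>imp_K\<close> gives \<open>\<one> \<rightarrow> t = \<one>\<close>. The converse \<open>t \<rightarrow> \<one> = \<one>\<close>
  comes from writing the inner unit as \<open>a \<rightarrow> (a \<rightarrow> a)\<close> and distributing with \<open>imp_S\<close>: what remains on
  the right is again an instance of \<open>imp_K\<close>.
\<close>

lemma imp_unit:
  assumes a: "a \<in> carrier H"
  shows "a \<leadsto> \<one> = \<one>"
proof (rule imp_antisym)
  have "(a \<leadsto> (a \<leadsto> (a \<leadsto> a))) \<leadsto> ((a \<leadsto> a) \<leadsto> (a \<leadsto> (a \<leadsto> a))) = \<one>"
    using a by (intro imp_S imp_closed)
  moreover have "a \<leadsto> (a \<leadsto> a) = \<one>" "(a \<leadsto> a) \<leadsto> (a \<leadsto> (a \<leadsto> a)) = \<one>"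
    using a imp_K[of "a \<leadsto> a" a] by (simp_all only: imp_K imp_closed)
  ultimately show "(a \<leadsto> \<one>) \<leadsto> \<one> = \<one>" by simp
qed (use a in \<open>auto intro: imp_closed unit_closed imp_K\<close>)

lemma unit_imp_eq_unitD: "\<lbrakk>a \<in> carrier H; \<one> \<leadsto> a = \<one>\<rbrakk> \<Longrightarrow> a = \<one>"
  using imp_antisym imp_unit unit_closed by blast

lemma imp_refl:
  assumes a: "a \<in> carrier H"
  shows "a \<leadsto> a = \<one>"
proof -
  have "(a \<leadsto> ((a \<leadsto> a) \<leadsto> a)) \<leadsto> ((a \<leadsto> (a \<leadsto> a)) \<leadsto> (a \<leadsto> a)) = \<one>"
    using a by (intro imp_S imp_closed)
  then have "\<one> \<leadsto> (\<one> \<leadsto> (a \<leadsto> a)) = \<one>"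
    using a by (simp add: imp_K imp_closed)
  then have "\<one> \<leadsto> (a \<leadsto> a) = \<one>"
    by (rule unit_imp_eq_unitD[rotated]) (simp add: a imp_closed unit_closed)
  then show ?thesis
    by (rule unit_imp_eq_unitD[rotated]) (simp add: a imp_closed)
qed

lemma filter_subset: "implicative_filter H F \<Longrightarrow> F \<subseteq> carrier H"
  and filter_unit: "implicative_filter H F \<Longrightarrow> \<one> \<in> F"
  and filter_mp: "\<lbrakk>implicative_filter H F; a \<in> F; a \<leadsto> b \<in> F; b \<in> carrier H\<rbrakk> \<Longrightarrow> b \<in> F"
  by (auto simp: implicative_filter_def)

lemma unit_filter: "implicative_filter H {\<one>}"
  by (auto simp: implicative_filter_def unit_closed intro: unit_imp_eq_unitD)

lemma spec_filter: "P \<in> spec H \<Longrightarrow> implicative_filter H P"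
  by (simp add: spec_def irreducible_filter_def)

text \<open>The filter generated by \<open>F\<close> and one further element \<open>x\<close> is \<open>{z. x \<rightarrow> z \<in> F}\<close>; this is the
  deduction theorem for Hilbert algebras.\<close>

lemma adjoin_filter:
  assumes F: "implicative_filter H F" and x: "x \<in> carrier H"
  shows "implicative_filter H {z \<in> carrier H. x \<leadsto> z \<in> F}"
proof -
  have "b \<in> carrier H \<and> x \<leadsto> b \<in> F"
    if a: "a \<in> carrier H" "x \<leadsto> a \<in> F" and b: "b \<in> carrier H" "x \<leadsto> (a \<leadsto> b) \<in> F" for a b
  proof -
    have "(x \<leadsto> (a \<leadsto> b)) \<leadsto> ((x \<leadsto> a) \<leadsto> (x \<leadsto> b)) \<in> F"
      using a b x filter_unit[OF F] by (simp add: imp_S)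
    then have "(x \<leadsto> a) \<leadsto> (x \<leadsto> b) \<in> F"
      by (rule filter_mp[OF F b(2)]) (simp add: a b x imp_closed)
    then show ?thesis
      using a b x filter_mp[OF F a(2)] by (auto intro: imp_closed)
  qed
  moreover have "\<one> \<in> carrier H \<and> x \<leadsto> \<one> \<in> F"
    using x filter_unit[OF F] by (simp add: unit_closed imp_unit)
  ultimately show ?thesis
    unfolding implicative_filter_def by blast
qed

lemma adjoin_filter_le_iff:
  assumes F: "implicative_filter H F" and P: "implicative_filter H P" and x: "x \<in> carrier H"
  shows "{z \<in> carrier H. x \<leadsto> z \<in> F} \<subseteq> P \<longleftrightarrow> F \<subseteq> P \<and> x \<in> P"
proof
  assume sub: "{z \<in> carrier H. x \<leadsto> z \<in> F} \<subseteq> P"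
  have "x \<leadsto> z \<in> F" if "z \<in> F" for z
  proof -
    have z: "z \<in> carrier H" using that filter_subset[OF F] by blast
    have "z \<leadsto> (x \<leadsto> z) \<in> F"
      using z x filter_unit[OF F] by (simp add: imp_K)
    then show ?thesis
      using filter_mp[OF F that] z x imp_closed by blast
  qed
  moreover have "x \<leadsto> x \<in> F"
    using x filter_unit[OF F] by (simp add: imp_refl)
  ultimately show "F \<subseteq> P \<and> x \<in> P"
    using sub x filter_subset[OF F] by blast
next
  assume "F \<subseteq> P \<and> x \<in> P"
  then show "{z \<in> carrier H. x \<leadsto> z \<in> F} \<subseteq> P"
    using filter_mp[OF P] by blast
qed

text \<open>A filter that is maximal among those above \<open>F\<close> and avoiding \<open>a\<close> is irreducible: if it is
  \<open>F\<^sub>1 \<inter> F\<^sub>2\<close>, then one of the \<open>F\<^sub>i\<close> avoids \<open>a\<close> as well and so cannot be larger.\<close>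

lemma irreducible_filter_separation:
  assumes F: "implicative_filter H F" and a: "a \<in> carrier H" "a \<notin> F"
  obtains P where "P \<in> spec H" "F \<subseteq> P" "a \<notin> P"
proof -
  define \<F> where "\<F> = {E. implicative_filter H E \<and> F \<subseteq> E \<and> a \<notin> E}"
  have "\<exists>M\<in>\<F>. \<forall>X\<in>\<F>. M \<subseteq> X \<longrightarrow> X = M"
  proof (rule subset_Zorn_nonempty)
    show "\<F> \<noteq> {}" using F a by (auto simp: \<F>_def)
  next
    fix \<C> assume ne: "\<C> \<noteq> {}" and ch: "subset.chain \<F> \<C>"
    have sub: "\<C> \<subseteq> \<F>" and lin: "\<And>X Y. X \<in> \<C> \<Longrightarrow> Y \<in> \<C> \<Longrightarrow> X \<subseteq> Y \<or> Y \<subseteq> X"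
      using ch by (auto simp: subset_chain_def)
    have fil: "implicative_filter H E" if "E \<in> \<C>" for E
      using that sub by (auto simp: \<F>_def)
    have "c \<in> \<Union>\<C>" if b: "b \<in> \<Union>\<C>" "b \<leadsto> c \<in> \<Union>\<C>" and c: "c \<in> carrier H" for b c
    proof -
      obtain X Y where XY: "X \<in> \<C>" "Y \<in> \<C>" "b \<in> X" "b \<leadsto> c \<in> Y"
        using b by blast
      then obtain Z where Z: "Z \<in> \<C>" "b \<in> Z" "b \<leadsto> c \<in> Z"
        using lin[OF XY(1,2)] by blast
      then show ?thesis
        using filter_mp[OF fil[OF Z(1)] Z(2,3) c] by blast
    qed
    moreover have "\<Union>\<C> \<subseteq> carrier H" using fil filter_subset by blast
    moreover have "\<one> \<in> \<Union>\<C>" using ne fil filter_unit by blast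
    ultimately have "implicative_filter H (\<Union>\<C>)"
      unfolding implicative_filter_def by blast
    then show "\<Union>\<C> \<in> \<F>" using ne sub by (auto simp: \<F>_def)
  qed
  then obtain M where M: "M \<in> \<F>" and max: "\<And>X. X \<in> \<F> \<Longrightarrow> M \<subseteq> X \<Longrightarrow> X = M"
    by blast
  have "M = F1 \<or> M = F2"
    if "implicative_filter H F1" "implicative_filter H F2" "M = F1 \<inter> F2" for F1 F2
  proof -
    have "F1 \<in> \<F> \<or> F2 \<in> \<F>" using that M by (auto simp: \<F>_def)
    then show ?thesis using max that(3) by blast
  qed
  then have "M \<in> spec H"
    using M a by (auto simp: \<F>_def spec_def irreducible_filter_def)
  then show thesis using that M by (auto simp: \<F>_def)
qed

lemma iterated_imp_closed:
  "\<lbrakk>set xs \<subseteq> carrier H; y \<in> carrier H\<rbrakk> \<Longrightarrow> foldr (imp H) xs y \<in> carrier H"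
  by (induction xs) (auto intro: imp_closed)

text \<open>Each antecedent is absorbed into the filter by the deduction theorem; once there are none
  left, separation applies.\<close>

lemma iterated_imp_mem_iff:
  assumes "implicative_filter H F" "set xs \<subseteq> carrier H" "y \<in> carrier H"
  shows "foldr (imp H) xs y \<in> F \<longleftrightarrow> (\<forall>P \<in> spec H. F \<subseteq> P \<longrightarrow> set xs \<subseteq> P \<longrightarrow> y \<in> P)"
  using assms
proof (induction xs arbitrary: F)
  case Nil
  then show ?case using irreducible_filter_separation[of F y] by auto
next
  case (Cons x xs)
  let ?F = "{z \<in> carrier H. x \<leadsto> z \<in> F}"
  have "foldr (imp H) (x # xs) y \<in> F \<longleftrightarrow> foldr (imp H) xs y \<in> ?F"
    using Cons.prems by (simp add: iterated_imp_closed)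
  also have "\<dots> \<longleftrightarrow> (\<forall>P \<in> spec H. ?F \<subseteq> P \<longrightarrow> set xs \<subseteq> P \<longrightarrow> y \<in> P)"
    using Cons.prems by (intro Cons.IH adjoin_filter) auto
  also have "\<dots> \<longleftrightarrow> (\<forall>P \<in> spec H. F \<subseteq> P \<longrightarrow> set (x # xs) \<subseteq> P \<longrightarrow> y \<in> P)"
    using Cons.prems by (auto simp: adjoin_filter_le_iff spec_filter)
  finally show ?case .
qed

lemma phi_inj: "inj_on (phi H) (carrier H)"
proof (rule inj_onI)
  have "a \<leadsto> b = \<one>" if "a \<in> carrier H" "b \<in> carrier H" "phi H a = phi H b" for a b
    using iterated_imp_mem_iff[OF unit_filter, of "[a]" b] that
    by (auto simp: phi_def set_eq_iff)
  then show "a = b" if "a \<in> carrier H" "b \<in> carrier H" "phi H a = phi H b" for a b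
    using that by (metis imp_antisym)
qed

end

section \<open>The implicative semilattice generated by a Hilbert algebra\<close>

lemma upset_algebra_sel [simp]:
  "carrier (upset_algebra H) = spec_upsets H"
  "imp (upset_algebra H) U V = {P \<in> spec H. \<forall>Q \<in> spec H. P \<subseteq> Q \<longrightarrow> Q \<in> U \<longrightarrow> Q \<in> V}"
  "unit (upset_algebra H) = spec H"
  "meet (upset_algebra H) U V = U \<inter> V"
  by (auto simp: upset_algebra_def spec_down_def)

lemma IS_obj_sel [simp]:
  "imp (IS_obj H) = imp (upset_algebra H)"
  "unit (IS_obj H) = spec H"
  "meet (IS_obj H) U V = U \<inter> V"
  by (simp_all add: IS_obj_def upset_algebra_def)

lemma carrier_IS_obj:
  "carrier (IS_obj H) = implicative_subsemilattice (upset_algebra H) hull (phi H ` carrier H)"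
  by (simp add: IS_obj_def)

lemma phi_in_IS_obj: "a \<in> carrier H \<Longrightarrow> phi H a \<in> carrier (IS_obj H)"
  unfolding carrier_IS_obj by (meson hull_subset image_eqI subset_iff)

definition spec_above :: "('a, 'm) hil_scheme \<Rightarrow> 'a set \<Rightarrow> 'a set set"
  where "spec_above H A = {P \<in> spec H. A \<subseteq> P}"

lemma phi_eq_spec_above: "phi H a = spec_above H {a}"
  by (auto simp: phi_def spec_above_def)

lemma spec_above_empty: "spec_above H {} = spec H"
  by (simp add: spec_above_def)

lemma spec_above_Un: "spec_above H (A \<union> B) = spec_above H A \<inter> spec_above H B"
  by (auto simp: spec_above_def)

lemma spec_above_upset: "spec_above H A \<in> spec_upsets H"
  by (auto simp: spec_above_def spec_upsets_def)

context hilbert_algebra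
begin

lemma imp_spec_above:
  assumes "set xs \<subseteq> carrier H" "B \<subseteq> carrier H"
  shows "imp (upset_algebra H) (spec_above H (set xs)) (spec_above H B) =
    spec_above H (foldr (imp H) xs ` B)"
proof -
  have "foldr (imp H) xs b \<in> P \<longleftrightarrow> (\<forall>Q \<in> spec H. P \<subseteq> Q \<longrightarrow> set xs \<subseteq> Q \<longrightarrow> b \<in> Q)"
    if "P \<in> spec H" "b \<in> B" for P b
    using that assms by (intro iterated_imp_mem_iff spec_filter) auto
  then have "(\<forall>b \<in> B. foldr (imp H) xs b \<in> P) \<longleftrightarrow>
      (\<forall>Q \<in> spec H. P \<subseteq> Q \<longrightarrow> set xs \<subseteq> Q \<longrightarrow> B \<subseteq> Q)" if "P \<in> spec H" for P
    using that by (simp add: subset_iff) blast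
  then show ?thesis
    unfolding spec_above_def upset_algebra_sel image_subset_iff by auto
qed

lemma phi_imp:
  "\<lbrakk>a \<in> carrier H; b \<in> carrier H\<rbrakk> \<Longrightarrow>
    phi H (a \<leadsto> b) = imp (upset_algebra H) (phi H a) (phi H b)"
  using imp_spec_above[of "[a]" "{b}"]
  by (simp add: phi_eq_spec_above del: upset_algebra_sel)

lemma phi_unit: "phi H \<one> = spec H"
  using filter_unit[OF spec_filter] by (auto simp: phi_def)

text \<open>Finite sets are given by lists because iterated implication needs an order of the
  antecedents.\<close>

lemma spec_above_subsemilattice:
  "implicative_subsemilattice (upset_algebra H) {spec_above H (set xs) | xs. set xs \<subseteq> carrier H}"
    (is "implicative_subsemilattice _ ?B")
proof -
  have "spec_above H (set xs) \<inter> spec_above H (set ys) \<in> ?B"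
    "imp (upset_algebra H) (spec_above H (set xs)) (spec_above H (set ys)) \<in> ?B"
    if "set xs \<subseteq> carrier H" "set ys \<subseteq> carrier H" for xs ys
  proof -
    have "spec_above H (set xs) \<inter> spec_above H (set ys) = spec_above H (set (xs @ ys))"
      by (simp add: spec_above_Un)
    moreover have "set (xs @ ys) \<subseteq> carrier H"
      using that by simp
    ultimately show "spec_above H (set xs) \<inter> spec_above H (set ys) \<in> ?B"
      by blast
    have "imp (upset_algebra H) (spec_above H (set xs)) (spec_above H (set ys)) =
        spec_above H (set (map (foldr (imp H) xs) ys))"
      using that by (simp only: imp_spec_above set_map)
    moreover have "set (map (foldr (imp H) xs) ys) \<subseteq> carrier H"
      using that by (auto intro: iterated_imp_closed)
    ultimately show "imp (upset_algebra H) (spec_above H (set xs)) (spec_above H (set ys)) \<in> ?B"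
      by blast
  qed
  moreover have "spec H \<in> ?B"
    by (rule CollectI, rule exI[of _ "[]"]) (simp add: spec_above_empty)
  moreover have "?B \<subseteq> spec_upsets H"
    using spec_above_upset by blast
  ultimately show "implicative_subsemilattice (upset_algebra H) ?B"
    unfolding implicative_subsemilattice_def by (auto simp del: upset_algebra_sel(2))
qed

lemma carrier_IS_obj_eq:
  "carrier (IS_obj H) = {spec_above H (set xs) | xs. set xs \<subseteq> carrier H}" (is "_ = ?B")
proof (unfold carrier_IS_obj, rule hull_unique)
  show "phi H ` carrier H \<subseteq> ?B"
  proof
    fix U assume "U \<in> phi H ` carrier H"
    then obtain a where "a \<in> carrier H" "U = spec_above H (set [a])"
      by (auto simp: phi_eq_spec_above)
    then show "U \<in> ?B" by fastforce
  qed
next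
  show "implicative_subsemilattice (upset_algebra H) ?B"
    by (rule spec_above_subsemilattice)
next
  fix S assume gen: "phi H ` carrier H \<subseteq> S" and S: "implicative_subsemilattice (upset_algebra H) S"
  have "spec_above H (set xs) \<in> S" if "set xs \<subseteq> carrier H" for xs
    using that
  proof (induction xs)
    case Nil
    then show ?case using S by (simp add: implicative_subsemilattice_def spec_above_empty)
  next
    case (Cons x xs)
    have "spec_above H (set (x # xs)) = phi H x \<inter> spec_above H (set xs)"
      by (auto simp: spec_above_def phi_def)
    moreover have "phi H x \<in> S" "spec_above H (set xs) \<in> S"
      using Cons gen by auto
    ultimately show ?case using S by (simp add: implicative_subsemilattice_def)
  qed
  then show "?B \<subseteq> S" by blast
qed

lemma IS_obj_subsemilattice: "implicative_subsemilattice (upset_algebra H) (carrier (IS_obj H))"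
  unfolding carrier_IS_obj_eq by (rule spec_above_subsemilattice)

lemma IS_objE:
  assumes "U \<in> carrier (IS_obj H)"
  obtains xs where "U = spec_above H (set xs)" "set xs \<subseteq> carrier H"
  using assms by (auto simp: carrier_IS_obj_eq)

lemma spec_above_in_IS_obj:
  "set xs \<subseteq> carrier H \<Longrightarrow> spec_above H (set xs) \<in> carrier (IS_obj H)"
  by (auto simp: carrier_IS_obj_eq)

lemma IS_obj_upset: "U \<in> carrier (IS_obj H) \<Longrightarrow> U \<in> spec_upsets H"
  by (auto elim: IS_objE simp: spec_above_upset)

lemma IS_obj_implicative_semilattice: "implicative_semilattice (IS_obj H)"
proof
  fix U V W assume U: "U \<in> carrier (IS_obj H)"
  then have up: "U \<subseteq> spec H" "\<And>P Q. \<lbrakk>P \<in> U; Q \<in> spec H; P \<subseteq> Q\<rbrakk> \<Longrightarrow> Q \<in> U"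
    using IS_obj_upset by (auto simp: spec_upsets_def)
  then show "U \<sqsubseteq>\<^bsub>IS_obj H\<^esub> \<one>\<^bsub>IS_obj H\<^esub>"
    by (auto simp: isl_le_def)
  assume V: "V \<in> carrier (IS_obj H)"
  show "U \<sqinter>\<^bsub>IS_obj H\<^esub> V \<in> carrier (IS_obj H)" "U \<leadsto>\<^bsub>IS_obj H\<^esub> V \<in> carrier (IS_obj H)"
    using U V IS_obj_subsemilattice
    by (simp_all add: implicative_subsemilattice_def)
  show "U \<sqinter>\<^bsub>IS_obj H\<^esub> V \<sqsubseteq>\<^bsub>IS_obj H\<^esub> W \<longleftrightarrow> U \<sqsubseteq>\<^bsub>IS_obj H\<^esub> V \<leadsto>\<^bsub>IS_obj H\<^esub> W"
    using up by (fastforce simp: isl_le_def)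
qed (use IS_obj_subsemilattice in \<open>auto simp: implicative_subsemilattice_def\<close>)

text \<open>The elements at which two homomorphisms agree form an implicative subsemilattice.\<close>

lemma IS_obj_hom_eqI:
  assumes g: "g \<in> isl_hom (IS_obj H) G" and h: "h \<in> isl_hom (IS_obj H) G"
    and eq: "\<And>a. a \<in> carrier H \<Longrightarrow> g (phi H a) = h (phi H a)"
  shows "g = h"
proof -
  let ?S = "{U \<in> carrier (IS_obj H). g U = h U}"
  have "implicative_subsemilattice (upset_algebra H) ?S"
    using g h IS_obj_subsemilattice
    by (auto simp: implicative_subsemilattice_def isl_hom_def)
  moreover have "phi H ` carrier H \<subseteq> ?S"
    using eq by (auto simp: phi_in_IS_obj)
  ultimately have "carrier (IS_obj H) \<subseteq> ?S"
    unfolding carrier_IS_obj by (metis (no_types, lifting) hull_minimal)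
  moreover have "g \<in> extensional (carrier (IS_obj H))" "h \<in> extensional (carrier (IS_obj H))"
    using g h by (auto simp: isl_hom_def PiE_def)
  ultimately show ?thesis
    by (blast intro: extensionalityI)
qed

end

section \<open>The action on homomorphisms\<close>

lemma hil_hom_closed: "\<lbrakk>f \<in> hil_hom H K; a \<in> carrier H\<rbrakk> \<Longrightarrow> f a \<in> carrier K"
  by (auto simp: hil_hom_def)

locale hilbert_hom = dom: hilbert_algebra H + cod: hilbert_algebra K
  for H :: "('a, 'm) hil_scheme" and K :: "('b, 'n) hil_scheme" +
  fixes f
  assumes hom: "f \<in> hil_hom H K"
begin

lemma preimage_filter:
  assumes "implicative_filter K F"
  shows "implicative_filter H (f -` F \<inter> carrier H)"
  using assms hom hil_hom_closed[OF hom]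
  by (auto simp: implicative_filter_def hil_hom_def dom.unit_closed)

lemma hom_iterated_imp:
  "\<lbrakk>set xs \<subseteq> carrier H; y \<in> carrier H\<rbrakk> \<Longrightarrow>
    f (foldr (imp H) xs y) = foldr (imp K) (map f xs) (f y)"
  using hom by (induction xs) (auto simp: hil_hom_def dom.iterated_imp_closed)

text \<open>The filter \<open>f\<^sup>-\<^sup>1 P\<close> is the intersection of the irreducible filters \<open>R\<^sub>f(P)\<close>, so all of these
  contain \<open>A\<close> iff \<open>f\<^sup>-\<^sup>1 P\<close> does. This covers the case that \<open>f\<^sup>-\<^sup>1 P\<close> is not proper, where
  \<open>R\<^sub>f(P)\<close> is empty.\<close>

lemma IS_map_spec_above:
  assumes xs: "set xs \<subseteq> carrier H"
  shows "IS_map H K f (spec_above H (set xs)) = spec_above K (f ` set xs)"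
proof -
  have "filter_rel H K f `` {P} \<subseteq> spec_above H (set xs) \<longleftrightarrow> f ` set xs \<subseteq> P"
    if P: "P \<in> spec K" for P
  proof -
    have "x \<in> f -` P \<inter> carrier H \<longleftrightarrow> (\<forall>Q \<in> spec H. f -` P \<inter> carrier H \<subseteq> Q \<longrightarrow> x \<in> Q)"
      if "x \<in> set xs" for x
      using dom.iterated_imp_mem_iff[OF preimage_filter[OF cod.spec_filter[OF P]], of "[]" x]
        that xs by auto
    then show ?thesis
      using P xs by (fastforce simp: filter_rel_def spec_above_def)
  qed
  then show ?thesis
    using dom.spec_above_in_IS_obj[OF xs] by (auto simp: IS_map_def spec_above_def)
qed

lemma IS_map_phi: "a \<in> carrier H \<Longrightarrow> IS_map H K f (phi H a) = phi K (f a)"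
  using IS_map_spec_above[of "[a]"] by (simp add: phi_eq_spec_above)

lemma IS_map_hom: "IS_map H K f \<in> isl_hom (IS_obj H) (IS_obj K)"
proof -
  let ?m = "IS_map H K f"
  have img: "f ` set xs \<subseteq> carrier K" if "set xs \<subseteq> carrier H" for xs
    using that hil_hom_closed[OF hom] by blast
  have clos: "?m U \<in> carrier (IS_obj K)" if U: "U \<in> carrier (IS_obj H)" for U
  proof -
    obtain xs where xs: "U = spec_above H (set xs)" "set xs \<subseteq> carrier H"
      using U by (rule dom.IS_objE)
    then have "?m U = spec_above K (set (map f xs))"
      by (simp add: IS_map_spec_above)
    then show ?thesis
      using img[OF xs(2)] cod.spec_above_in_IS_obj[of "map f xs"] by simp
  qed
  have meet: "?m (U \<inter> V) = ?m U \<inter> ?m V"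
    and imp: "?m (imp (upset_algebra H) U V) = imp (upset_algebra K) (?m U) (?m V)"
    if U: "U \<in> carrier (IS_obj H)" and V: "V \<in> carrier (IS_obj H)" for U V
  proof -
    obtain xs where xs: "U = spec_above H (set xs)" "set xs \<subseteq> carrier H"
      using U by (rule dom.IS_objE)
    obtain ys where ys: "V = spec_above H (set ys)" "set ys \<subseteq> carrier H"
      using V by (rule dom.IS_objE)
    have "?m (U \<inter> V) = spec_above K (f ` set (xs @ ys))"
      using xs ys IS_map_spec_above[of "xs @ ys"] by (simp add: spec_above_Un)
    then show "?m (U \<inter> V) = ?m U \<inter> ?m V"
      using xs ys by (simp add: IS_map_spec_above image_Un spec_above_Un)
    have "?m (imp (upset_algebra H) U V) =
        ?m (spec_above H (set (map (foldr (imp H) xs) ys)))"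
      using xs ys by (simp only: dom.imp_spec_above set_map)
    also have "\<dots> = spec_above K (f ` set (map (foldr (imp H) xs) ys))"
      using xs ys by (intro IS_map_spec_above) (auto intro: dom.iterated_imp_closed)
    also have "f ` set (map (foldr (imp H) xs) ys) = foldr (imp K) (map f xs) ` f ` set ys"
      unfolding set_map image_image
      by (rule image_cong) (use xs ys in \<open>auto simp: hom_iterated_imp\<close>)
    also have "spec_above K \<dots> =
        imp (upset_algebra K) (spec_above K (set (map f xs))) (spec_above K (f ` set ys))"
      using xs ys img by (intro cod.imp_spec_above[symmetric]) auto
    also have "\<dots> = imp (upset_algebra K) (?m U) (?m V)"
      using xs ys by (simp only: IS_map_spec_above set_map)
    finally show "?m (imp (upset_algebra H) U V) = imp (upset_algebra K) (?m U) (?m V)" .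
  qed
  have top: "?m (spec H) = spec K"
    using IS_map_spec_above[of "[]"] by (simp add: spec_above_empty)
  have "?m \<in> carrier (IS_obj H) \<rightarrow>\<^sub>E carrier (IS_obj K)"
    using clos by (auto simp: IS_map_def)
  then show ?thesis
    unfolding isl_hom_def IS_obj_sel using meet imp top by blast
qed

end

lemma hil_hom_id: "(\<lambda>a \<in> carrier H. a) \<in> hil_hom H H" if "hilbert_algebra H"
proof -
  interpret hilbert_algebra H by fact
  show ?thesis by (auto simp: hil_hom_def imp_closed unit_closed)
qed

lemma hil_hom_compose:
  assumes "hilbert_algebra H" "f \<in> hil_hom H K" "g \<in> hil_hom K L"
  shows "compose (carrier H) g f \<in> hil_hom H L"
proof -
  interpret hilbert_algebra H by fact
  have "f a \<in> carrier K" if "a \<in> carrier H" for a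
    using assms(2) that by (rule hil_hom_closed)
  then show ?thesis
    using assms(2,3) by (auto simp: hil_hom_def compose_def imp_closed unit_closed)
qed

lemma isl_hom_compose:
  assumes "implicative_semilattice H" "f \<in> isl_hom H K" "g \<in> isl_hom K L"
  shows "compose (carrier H) g f \<in> isl_hom H L"
proof -
  interpret implicative_semilattice H by fact
  have "f a \<in> carrier K" if "a \<in> carrier H" for a
    using assms(2) that by (auto simp: isl_hom_def)
  then show ?thesis
    using assms(2,3) by (auto simp: isl_hom_def compose_def imp_closed unit_closed meet_closed)
qed

text \<open>By uniqueness of extensions, functoriality need only be checked on the elements \<open>\<phi> a\<close>.\<close>

lemma IS_map_id:
  assumes H: "hilbert_algebra H"
  shows "IS_map H H (\<lambda>a \<in> carrier H. a) = (\<lambda>U \<in> carrier (IS_obj H). U)"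
proof -
  interpret hilbert_algebra H by fact
  interpret hilbert_hom H H "\<lambda>a \<in> carrier H. a"
    using hil_hom_id[OF H] by unfold_locales
  interpret IS: implicative_semilattice "IS_obj H" by (rule IS_obj_implicative_semilattice)
  have "(\<lambda>U \<in> carrier (IS_obj H). U) \<in> isl_hom (IS_obj H) (IS_obj H)"
    using IS.meet_closed IS.imp_closed IS.unit_closed by (auto simp: isl_hom_def)
  then show ?thesis
    by (rule IS_obj_hom_eqI[OF IS_map_hom]) (simp add: IS_map_phi phi_in_IS_obj)
qed

lemma IS_map_compose:
  assumes "hilbert_algebra H" "hilbert_algebra K" "hilbert_algebra L"
    and f: "f \<in> hil_hom H K" and g: "g \<in> hil_hom K L"
  shows "IS_map H L (compose (carrier H) g f) =
    compose (carrier (IS_obj H)) (IS_map K L g) (IS_map H K f)"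
proof -
  interpret H: hilbert_algebra H by fact
  interpret f: hilbert_hom H K f using assms by (intro hilbert_hom.intro hilbert_hom_axioms.intro)
  interpret g: hilbert_hom K L g using assms by (intro hilbert_hom.intro hilbert_hom_axioms.intro)
  interpret gf: hilbert_hom H L "compose (carrier H) g f"
    using assms by (intro hilbert_hom.intro hilbert_hom_axioms.intro hil_hom_compose)
  show ?thesis
    by (rule H.IS_obj_hom_eqI[OF gf.IS_map_hom
          isl_hom_compose[OF H.IS_obj_implicative_semilattice f.IS_map_hom g.IS_map_hom]])
      (simp add: gf.IS_map_phi f.IS_map_phi g.IS_map_phi phi_in_IS_obj compose_eq
        hil_hom_closed[OF f])
qed

section \<open>Implicative semilattices as Hilbert algebras\<close>

lemma forget_sel [simp]:
  "carrier (forget G) = carrier G" "imp (forget G) = imp G" "unit (forget G) = unit G"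
  by (simp_all add: forget_def)

lemma isl_hom_subset_hil_hom: "isl_hom G K \<subseteq> hil_hom (forget G) (forget K)"
  by (auto simp: isl_hom_def hil_hom_def)

context implicative_semilattice
begin

lemma le_refl: "a \<in> carrier G \<Longrightarrow> a \<sqsubseteq> a"
  by (simp add: isl_le_def meet_idem)

lemma le_antisym: "\<lbrakk>a \<in> carrier G; b \<in> carrier G; a \<sqsubseteq> b; b \<sqsubseteq> a\<rbrakk> \<Longrightarrow> a = b"
  by (metis isl_le_def meet_commute)

lemma le_trans: "\<lbrakk>a \<in> carrier G; b \<in> carrier G; c \<in> carrier G; a \<sqsubseteq> b; b \<sqsubseteq> c\<rbrakk> \<Longrightarrow> a \<sqsubseteq> c"
  by (metis isl_le_def meet_assoc)

lemma meet_le1: "\<lbrakk>a \<in> carrier G; b \<in> carrier G\<rbrakk> \<Longrightarrow> a \<sqinter> b \<sqsubseteq> a"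
  unfolding isl_le_def by (metis meet_assoc meet_commute meet_idem)

lemma meet_le2: "\<lbrakk>a \<in> carrier G; b \<in> carrier G\<rbrakk> \<Longrightarrow> a \<sqinter> b \<sqsubseteq> b"
  unfolding isl_le_def by (metis meet_assoc meet_idem)

lemma le_meetI:
  "\<lbrakk>a \<in> carrier G; b \<in> carrier G; c \<in> carrier G; c \<sqsubseteq> a; c \<sqsubseteq> b\<rbrakk> \<Longrightarrow> c \<sqsubseteq> a \<sqinter> b"
  unfolding isl_le_def by (metis meet_assoc)

lemma le_iff_imp_eq_unit:
  assumes "a \<in> carrier G" "b \<in> carrier G"
  shows "a \<sqsubseteq> b \<longleftrightarrow> a \<leadsto> b = \<one>"
proof -
  have "\<one> \<sqinter> a = a"
    using assms le_unit unit_closed by (metis isl_le_def meet_commute)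
  then have "a \<sqsubseteq> b \<longleftrightarrow> \<one> \<sqsubseteq> a \<leadsto> b"
    using residuation[of "\<one>" a b] assms unit_closed by simp
  then show ?thesis
    using assms by (metis imp_closed le_antisym le_refl le_unit unit_closed)
qed

lemma imp_meet_le: "\<lbrakk>a \<in> carrier G; b \<in> carrier G\<rbrakk> \<Longrightarrow> (a \<leadsto> b) \<sqinter> a \<sqsubseteq> b"
  by (simp add: residuation imp_closed le_refl)

lemma imp_mp_le:
  "\<lbrakk>a \<in> carrier G; b \<in> carrier G; x \<in> carrier G; x \<sqsubseteq> a \<leadsto> b; x \<sqsubseteq> a\<rbrakk> \<Longrightarrow> x \<sqsubseteq> b"
  by (rule le_trans[of x "(a \<leadsto> b) \<sqinter> a" b])
    (simp_all add: imp_meet_le le_meetI imp_closed meet_closed)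

end

locale forget_semilattice = implicative_semilattice G
  for G :: "'d isl" (structure)
begin

lemma forget_hilbert_algebra: "hilbert_algebra (forget G)"
proof (unfold_locales, unfold forget_sel)
  fix a b c assume a: "a \<in> carrier G" and b: "b \<in> carrier G"
  show "a \<leadsto> (b \<leadsto> a) = \<one>"
    using a b by (simp add: le_iff_imp_eq_unit[symmetric] residuation[symmetric] imp_closed meet_le1)
  assume c: "c \<in> carrier G"
  let ?p = "a \<leadsto> (b \<leadsto> c)" and ?q = "a \<leadsto> b"
  let ?x = "(?p \<sqinter> ?q) \<sqinter> a"
  have cl: "?p \<in> carrier G" "?q \<in> carrier G" "?p \<sqinter> ?q \<in> carrier G" "?x \<in> carrier G"
    "b \<leadsto> c \<in> carrier G" "a \<leadsto> c \<in> carrier G"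
    using a b c by (auto intro: imp_closed meet_closed)
  have xa: "?x \<sqsubseteq> a" and xp: "?x \<sqsubseteq> ?p" and xq: "?x \<sqsubseteq> ?q"
    using a cl by (meson le_trans meet_le1 meet_le2)+
  have "?x \<sqsubseteq> c"
    using a b c cl xa xp xq by (meson imp_mp_le)
  then show "?p \<leadsto> (?q \<leadsto> (a \<leadsto> c)) = \<one>"
    using a c cl by (simp add: le_iff_imp_eq_unit[symmetric] residuation[symmetric] imp_closed)
qed (auto simp: imp_closed unit_closed le_iff_imp_eq_unit[symmetric] intro: le_antisym)

sublocale forget: hilbert_algebra "forget G"
  by (rule forget_hilbert_algebra)

text \<open>The filter condition gives closure under meets because \<open>a \<sqsubseteq> b \<rightarrow> a \<sqinter> b\<close>.\<close>

lemma filter_meet_iff: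
  assumes F: "implicative_filter (forget G) F" and a: "a \<in> carrier G" and b: "b \<in> carrier G"
  shows "a \<sqinter> b \<in> F \<longleftrightarrow> a \<in> F \<and> b \<in> F"
proof -
  have mp: "y \<in> F" if "x \<in> F" "x \<leadsto> y \<in> F" "y \<in> carrier G" for x y
    using forget.filter_mp[OF F, of x y] that by simp
  have one: "\<one> \<in> F" using forget.filter_unit[OF F] by simp
  have up: "y \<in> F" if "x \<in> F" "x \<in> carrier G" "y \<in> carrier G" "x \<sqsubseteq> y" for x y
    using mp[of x y] that one by (simp add: le_iff_imp_eq_unit)
  have "a \<sqsubseteq> b \<leadsto> a \<sqinter> b"
    using a b by (simp add: residuation[symmetric] meet_closed le_refl)
  then show ?thesis
    using a b up[of "a \<sqinter> b" a] up[of "a \<sqinter> b" b] up[of a "b \<leadsto> a \<sqinter> b"] mp[of b "a \<sqinter> b"]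
    by (auto simp: meet_closed imp_closed meet_le1 meet_le2)
qed

lemma phi_meet:
  "\<lbrakk>a \<in> carrier G; b \<in> carrier G\<rbrakk> \<Longrightarrow>
    phi (forget G) (a \<sqinter> b) = phi (forget G) a \<inter> phi (forget G) b"
  by (auto simp: phi_def filter_meet_iff forget.spec_filter)

text \<open>The image of \<open>\<phi>\<close> is already closed under all operations, so it is all of the generated
  subalgebra.\<close>

lemma phi_surj: "carrier (IS_obj (forget G)) = phi (forget G) ` carrier G"
proof -
  let ?\<phi> = "phi (forget G)"
  have "implicative_subsemilattice (upset_algebra (forget G)) (?\<phi> ` carrier G)"
    unfolding implicative_subsemilattice_def
  proof (intro conjI ballI)
    show "?\<phi> ` carrier G \<subseteq> carrier (upset_algebra (forget G))"
      by (auto simp: phi_eq_spec_above spec_above_upset)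
    show "\<one>\<^bsub>upset_algebra (forget G)\<^esub> \<in> ?\<phi> ` carrier G"
      using forget.phi_unit unit_closed by (force simp: image_iff)
  next
    fix U V assume "U \<in> ?\<phi> ` carrier G" "V \<in> ?\<phi> ` carrier G"
    then obtain a b where ab: "a \<in> carrier G" "b \<in> carrier G" "U = ?\<phi> a" "V = ?\<phi> b"
      by blast
    show "U \<sqinter>\<^bsub>upset_algebra (forget G)\<^esub> V \<in> ?\<phi> ` carrier G"
      using ab by (auto simp: phi_meet[symmetric] meet_closed)
    show "U \<leadsto>\<^bsub>upset_algebra (forget G)\<^esub> V \<in> ?\<phi> ` carrier G"
      using ab by (auto simp: forget.phi_imp[simplified forget_sel, symmetric] imp_closed
          simp del: upset_algebra_sel)
  qed
  then have "carrier (IS_obj (forget G)) \<subseteq> ?\<phi> ` carrier G"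
    unfolding carrier_IS_obj by (intro hull_minimal) auto
  then show ?thesis
    using phi_in_IS_obj[of _ "forget G"] by auto
qed

text \<open>The inverse isomorphism, which is the counit of the adjunction.\<close>

lemma phi_inverse_hom:
  "(\<lambda>U \<in> carrier (IS_obj (forget G)). inv_into (carrier G) (phi (forget G)) U)
    \<in> isl_hom (IS_obj (forget G)) G"
proof -
  let ?\<phi> = "phi (forget G)" and ?S = "carrier (IS_obj (forget G))"
  let ?\<epsilon> = "\<lambda>U \<in> ?S. inv_into (carrier G) ?\<phi> U"
  have inS: "?\<phi> a \<in> ?S" if "a \<in> carrier G" for a
    using that phi_surj by blast
  have eps: "?\<epsilon> (?\<phi> a) = a" if "a \<in> carrier G" for a
    using that forget.phi_inj inS by (simp add: inv_into_f_f)
  have "?\<epsilon> (U \<inter> V) = ?\<epsilon> U \<sqinter> ?\<epsilon> V"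
    "?\<epsilon> (imp (upset_algebra (forget G)) U V) = ?\<epsilon> U \<leadsto> ?\<epsilon> V"
    if UV: "U \<in> ?S" "V \<in> ?S" for U V
  proof -
    obtain a b where ab: "a \<in> carrier G" "b \<in> carrier G" "U = ?\<phi> a" "V = ?\<phi> b"
      using UV phi_surj by auto
    show "?\<epsilon> (U \<inter> V) = ?\<epsilon> U \<sqinter> ?\<epsilon> V"
      using ab eps by (metis phi_meet meet_closed)
    show "?\<epsilon> (imp (upset_algebra (forget G)) U V) = ?\<epsilon> U \<leadsto> ?\<epsilon> V"
      using ab eps by (metis forget.phi_imp forget_sel(1,2) imp_closed)
  qed
  moreover have "?\<epsilon> (spec (forget G)) = \<one>"
    using eps[OF unit_closed] by (simp add: forget.phi_unit[simplified forget_sel])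
  moreover have "?\<epsilon> \<in> ?S \<rightarrow>\<^sub>E carrier G"
    using eps phi_surj by auto
  ultimately show ?thesis
    unfolding isl_hom_def IS_obj_sel by blast
qed

end

section \<open>The adjunction\<close>

lemma hom_transpose_apply: "a \<in> carrier H \<Longrightarrow> hom_transpose H h a = h (phi H a)"
  by (simp add: hom_transpose_def compose_eq)

text \<open>The transpose of \<open>f : H \<rightarrow> U G\<close> under the hom-set bijection is \<open>\<epsilon> \<circ> f\<^sup>I\<^sup>S\<close>, where \<open>\<epsilon>\<close> is
  the counit; then \<open>\<epsilon> (f\<^sup>I\<^sup>S (\<phi> a)) = \<epsilon> (\<phi> (f a)) = f a\<close>.\<close>

lemma hom_transpose_bij:
  assumes H: "hilbert_algebra H" and G: "implicative_semilattice G"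
  shows "bij_betw (hom_transpose H) (isl_hom (IS_obj H) G) (hil_hom H (forget G))"
proof (rule bij_betw_imageI)
  interpret H: hilbert_algebra H by fact
  interpret G: forget_semilattice G using G by (rule forget_semilattice.intro)
  show "inj_on (hom_transpose H) (isl_hom (IS_obj H) G)"
  proof (rule inj_onI)
    fix g h assume g: "g \<in> isl_hom (IS_obj H) G" and h: "h \<in> isl_hom (IS_obj H) G"
      and eq: "hom_transpose H g = hom_transpose H h"
    show "g = h"
      using g h by (rule H.IS_obj_hom_eqI) (metis hom_transpose_apply eq)
  qed
  have closed: "hom_transpose H h \<in> hil_hom H (forget G)" if h: "h \<in> isl_hom (IS_obj H) G" for h
  proof -
    have "h (phi H a) \<in> carrier G" if "a \<in> carrier H" for a
      using phi_in_IS_obj[OF that] h by (auto simp: isl_hom_def)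
    moreover have "h (phi H (a \<leadsto>\<^bsub>H\<^esub> b)) = h (phi H a) \<leadsto>\<^bsub>G\<^esub> h (phi H b)"
      if "a \<in> carrier H" "b \<in> carrier H" for a b
      using that h by (simp add: isl_hom_def H.phi_imp phi_in_IS_obj del: upset_algebra_sel)
    moreover have "h (phi H \<one>\<^bsub>H\<^esub>) = \<one>\<^bsub>G\<^esub>"
      using h by (simp add: isl_hom_def H.phi_unit)
    moreover have "hom_transpose H h \<in> extensional (carrier H)"
      by (simp add: hom_transpose_def compose_def)
    ultimately show ?thesis
      by (auto simp: hil_hom_def hom_transpose_apply H.imp_closed H.unit_closed PiE_def)
  qed
  have "f \<in> hom_transpose H ` isl_hom (IS_obj H) G" if f: "f \<in> hil_hom H (forget G)" for f
  proof
    interpret f: hilbert_hom H "forget G" f using f by unfold_locales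
    let ?\<epsilon> = "\<lambda>U \<in> carrier (IS_obj (forget G)). inv_into (carrier G) (phi (forget G)) U"
    let ?h = "compose (carrier (IS_obj H)) ?\<epsilon> (IS_map H (forget G) f)"
    show "?h \<in> isl_hom (IS_obj H) G"
      by (rule isl_hom_compose[OF H.IS_obj_implicative_semilattice f.IS_map_hom G.phi_inverse_hom])
    have fa: "f a \<in> carrier G" if "a \<in> carrier H" for a
      using hil_hom_closed[OF f that] by simp
    have "hom_transpose H ?h a = f a" if a: "a \<in> carrier H" for a
      using a fa[OF a] G.forget.phi_inj phi_in_IS_obj[of "f a" "forget G"]
      by (simp add: hom_transpose_apply compose_eq phi_in_IS_obj f.IS_map_phi inv_into_f_f)
    moreover have "f \<in> extensional (carrier H)" using f by (simp add: hil_hom_def PiE_def)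
    ultimately show "f = hom_transpose H ?h"
      by (intro extensionalityI[of _ "carrier H"]) (simp_all add: hom_transpose_def compose_def)
  qed
  then show "hom_transpose H ` isl_hom (IS_obj H) G = hil_hom H (forget G)"
    using closed by blast
qed

lemma hom_transpose_natural_left:
  assumes "hilbert_algebra K" "hilbert_algebra H" and f: "f \<in> hil_hom K H"
  shows "hom_transpose K (compose (carrier (IS_obj K)) h (IS_map K H f)) =
    compose (carrier K) (hom_transpose H h) f"
proof -
  interpret hilbert_hom K H f
    using assms by (intro hilbert_hom.intro hilbert_hom_axioms.intro)
  show ?thesis
    using hil_hom_closed[OF f]
    by (auto simp: hom_transpose_def compose_def phi_in_IS_obj IS_map_phi)
qed

lemma hom_transpose_natural_right:
  "hom_transpose H (compose (carrier (IS_obj H)) g h) = compose (carrier H) g (hom_transpose H h)"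
  by (auto simp: hom_transpose_def compose_def phi_in_IS_obj)

theorem theorem10:
  fixes H :: "'a hil" and H' :: "'b hil" and H'' :: "'c hil"
    and G :: "'d isl" and G' :: "'e isl"
  assumes "hilbert_algebra H" and "hilbert_algebra H'" and "hilbert_algebra H''"
    and "implicative_semilattice G" and "implicative_semilattice G'"
  shows
    \<comment> \<open>U is a functor from IS to Hil\<close>
    "(hilbert_algebra (forget G) \<and> isl_hom G G' \<subseteq> hil_hom (forget G) (forget G')) \<and>
    \<comment> \<open>H \<mapsto> H^IS, f \<mapsto> f^IS is a functor from Hil to IS\<close>
    (implicative_semilattice (IS_obj H) \<and>
     (\<forall>f \<in> hil_hom H H'. IS_map H H' f \<in> isl_hom (IS_obj H) (IS_obj H')) \<and>
     IS_map H H (\<lambda>a \<in> carrier H. a) = (\<lambda>U \<in> carrier (IS_obj H). U) \<and>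
     (\<forall>f \<in> hil_hom H H'. \<forall>g \<in> hil_hom H' H''.
        IS_map H H'' (compose (carrier H) g f) =
        compose (carrier (IS_obj H)) (IS_map H' H'' g) (IS_map H H' f))) \<and>
    \<comment> \<open>bijection between Hom(H^IS, G) and Hom(H, U G), natural in H and in G\<close>
    (bij_betw (hom_transpose H) (isl_hom (IS_obj H) G) (hil_hom H (forget G)) \<and>
     (\<forall>f \<in> hil_hom H' H. \<forall>h \<in> isl_hom (IS_obj H) G.
        hom_transpose H' (compose (carrier (IS_obj H')) h (IS_map H' H f)) =
        compose (carrier H') (hom_transpose H h) f) \<and>
     (\<forall>g \<in> isl_hom G G'. \<forall>h \<in> isl_hom (IS_obj H) G.
        hom_transpose H (compose (carrier (IS_obj H)) g h) =
        compose (carrier H) g (hom_transpose H h)))"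
proof (intro conjI ballI)
  show "IS_map H H' f \<in> isl_hom (IS_obj H) (IS_obj H')" if "f \<in> hil_hom H H'" for f
    using assms that by (intro hilbert_hom.IS_map_hom hilbert_hom.intro hilbert_hom_axioms.intro)
qed (use assms in \<open>auto intro: forget_semilattice.forget_hilbert_algebra forget_semilattice.intro
    hilbert_algebra.IS_obj_implicative_semilattice IS_map_compose
    hom_transpose_natural_left hom_transpose_natural_right IS_map_id hom_transpose_bij
    dest: subsetD[OF isl_hom_subset_hil_hom]\<close>)

end
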